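(* Let $r\geq 2$ be an integer and $\alpha\in(0,1)$. Let $t=t(n)$ and $b=b(n)$ be such that there exists a successful $(t,b)$-strategy for an $\alpha$-$K_r$-factor. Then $b=\Omega\big(n^{r-1}/t^{r/2-1}\big)$.
   Context: Budget-constrained random graph process: let $M=\binom{n}{2}$. The edges of $K_n$ on vertex set $[n]$ are put in a uniformly random order $e_1,e_2,\ldots,e_M$. Builder is presented $e_1,\ldots,e_t$ one by one and, as each edge is presented and without knowledge of future edges, must irrevocably decide (possibly using additional randomness) whether to purchase it; she may purchase at most $b$ edges in total. A $(t,b)$-strategy is a rule for these decisions; $B_t$ denotes the graph of purchased edges after time $t$. (Strategies are really sequences of strategies indexed by $n$.) A strategy is successful for a property $\mathcal{P}$ if $B_t$ satisfies $\mathcal{P}$ with probability tending to $1$ as $n\to\infty$. For a graph $F$ and $\alpha\in(0,1)$, a graph $G$ on $n$ vertices contains an $\alpha$-$F$-factor if it contains at least $\alpha n/|V(F)|$ vertex-disjoint copies of $F$. $K_r$ is the complete graph on $r$ vertices. *)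

theory Defs
  imports "HOL-Probability.Probability" "HOL-Combinatorics.Multiset_Permutations"
    "HOL-Library.Landau_Symbols"
begin

text \<open>Finite simple graphs are pairs of a vertex set and a set of two-element edges.\<close>

type_synonym 'a ugraph = "'a set \<times> 'a set set"

abbreviation verts :: "'a ugraph \<Rightarrow> 'a set" where "verts \<equiv> fst"
abbreviation edges :: "'a ugraph \<Rightarrow> 'a set set" where "edges \<equiv> snd"

definition wf_graph :: "'a ugraph \<Rightarrow> bool" where
  "wf_graph G \<longleftrightarrow> finite (verts G) \<and> (\<forall>e\<in>edges G. e \<subseteq> verts G \<and> card e = 2)"

definition complete_ugraph :: "nat \<Rightarrow> nat ugraph" where
  "complete_ugraph n = ({1..n}, {e. e \<subseteq> {1..n} \<and> card e = 2})"

definition subgraph :: "'a ugraph \<Rightarrow> 'a ugraph \<Rightarrow> bool" where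
  "subgraph H G \<longleftrightarrow> wf_graph H \<and> verts H \<subseteq> verts G \<and> edges H \<subseteq> edges G"

definition graph_iso :: "'a ugraph \<Rightarrow> 'b ugraph \<Rightarrow> bool" where
  "graph_iso F H \<longleftrightarrow> (\<exists>f. bij_betw f (verts F) (verts H) \<and> edges H = (\<lambda>e. f ` e) ` edges F)"

text \<open>Distinct members of \<open>C\<close> are required to have disjoint vertex sets, so \<open>card C\<close> counts
  vertex-disjoint (not necessarily induced) copies of \<open>F\<close>.\<close>

definition has_partial_factor :: "real \<Rightarrow> 'b ugraph \<Rightarrow> 'a ugraph \<Rightarrow> bool" where
  "has_partial_factor \<alpha> F G \<longleftrightarrow>
     (\<exists>C. finite C \<and> (\<forall>H\<in>C. subgraph H G \<and> graph_iso F H) \<and> disjoint_family_on verts C \<and>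
          real (card C) \<ge> \<alpha> * real (card (verts G)) / real (card (verts F)))"

text \<open>A history lists the edges presented so far, each with the decision whether it was purchased.
  A strategy maps the history and the edge currently presented to the distribution of the next
  decision. Since Builder remembers her past decisions, any use of additional randomness (for example
  a seed drawn in advance, independently of the edge order) induces such conditional distributions
  without changing the law of the process.\<close>

type_synonym history = "(nat set \<times> bool) list"
type_synonym strategy = "history \<Rightarrow> nat set \<Rightarrow> bool pmf"

primrec play :: "strategy \<Rightarrow> history \<Rightarrow> nat set list \<Rightarrow> history pmf" where
  "play S h [] = return_pmf h"
| "play S h (e # es) = bind_pmf (S h e) (\<lambda>d. play S (h @ [(e, d)]) es)"

definition purchased :: "history \<Rightarrow> nat set set" where
  "purchased h = {e. (e, True) \<in> set h}"

definition builder_graph :: "nat \<Rightarrow> nat \<Rightarrow> strategy \<Rightarrow> nat ugraph pmf" where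
  "builder_graph n t S =
     bind_pmf (pmf_of_set (permutations_of_set (edges (complete_ugraph n))))
       (\<lambda>es. map_pmf (\<lambda>h. ({1..n}, purchased h)) (play S [] (take t es)))"

text \<open>Every edge order has positive probability, so the budget is respected for every edge order
  and every outcome of Builder's randomness.\<close>

definition is_strategy :: "nat \<Rightarrow> nat \<Rightarrow> nat \<Rightarrow> strategy \<Rightarrow> bool" where
  "is_strategy n t b S \<longleftrightarrow> (\<forall>G\<in>set_pmf (builder_graph n t S). card (edges G) \<le> b)"

definition successful ::
    "(nat \<Rightarrow> nat) \<Rightarrow> (nat \<Rightarrow> nat) \<Rightarrow> (nat ugraph \<Rightarrow> bool) \<Rightarrow> (nat \<Rightarrow> strategy) \<Rightarrow> bool" where
  "successful t b P S \<longleftrightarrow>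
     (\<forall>n\<ge>1. is_strategy n (t n) (b n) (S n)) \<and>
     (\<lambda>n. measure_pmf.prob (builder_graph n (t n) (S n)) {G. P G}) \<longlonglongrightarrow> 1"

end

theory Submission
  imports Defs "HOL-Probability.Random_Permutations"
begin

text \<open>
  Write \<open>p = t / (n choose 2)\<close> and \<open>q = (b / n) / p\<close>. A clique that Builder completes arises, as in
  Kruskal's algorithm, from connected pieces: an edge inside a piece adds an edge to it, an edge
  between two disjoint pieces merges them. An edge inside a piece that already exists is presented
  later with probability at most \<open>p\<close>, whatever the strategy. Merging edges are chosen adaptively and
  may favour vertices in many pieces; this is controlled by calling a vertex alive as long as it lies
  in at most \<open>T k m\<close> pieces with \<open>k\<close> vertices and \<open>m\<close> edges, and by merging only at alive vertices.
  Then each of the at most \<open>b\<close> purchased edges merges boundedly many pairs, and induction on \<open>m\<close> bounds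
  the expected number of pieces by a constant times \<open>n q\<^sup>k p\<^sup>m / q\<close>. With \<open>T k m\<close> a large multiple of
  \<open>q\<^sup>k p\<^sup>m / q\<close>, only a small fraction of the vertices ever dies, so most cliques of the factor consist
  of alive vertices and are themselves pieces. Hence \<open>q ^ (r - 1) * p ^ (r choose 2)\<close> is bounded away
  from zero, which is the claim.
\<close>

subsection \<open>The random edge order\<close>

lemma prob_bind_pmf:
  "measure_pmf.prob (bind_pmf M f) X = measure_pmf.expectation M (\<lambda>x. measure_pmf.prob (f x) X)"
  unfolding measure_pmf_bind
  by (subst measure_pmf.measure_bind[where N = "count_space UNIV"])
     (auto simp: measurable_def measure_pmf_in_subprob_algebra)

text \<open>Generalises \<open>builder_graph\<close> to an arbitrary past \<open>h\<close> and a set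
  \<open>R\<close> of edges still to come, so that the process can be analysed by induction on the
  number \<open>k\<close> of remaining rounds.\<close>

definition game :: "strategy \<Rightarrow> history \<Rightarrow> nat set set \<Rightarrow> nat \<Rightarrow> history pmf" where
  "game S h R k = bind_pmf (pmf_of_set (permutations_of_set R)) (\<lambda>es. play S h (take k es))"

lemma builder_graph_eq_game:
  "builder_graph n t S =
     map_pmf (\<lambda>h. ({1..n}, purchased h)) (game S [] (edges (complete_ugraph n)) t)"
  by (simp add: builder_graph_def game_def map_bind_pmf)

lemma game_0 [simp]: "game S h R 0 = return_pmf h"
  by (simp add: game_def)

text \<open>The first edge of a uniform order of \<open>R\<close> is uniform and leaves a uniform
  order of \<open>R - {e}\<close>; the decision on it is independent of that order, so the two draws
  commute.\<close>

lemma game_Suc: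
  assumes "finite R" "R \<noteq> {}"
  shows "game S h R (Suc k) =
    bind_pmf (pmf_of_set R) (\<lambda>e. bind_pmf (S h e) (\<lambda>d. game S (h @ [(e, d)]) (R - {e}) k))"
proof -
  have "bind_pmf (pmf_of_set (permutations_of_set (R - {e})))
          (\<lambda>es. bind_pmf (S h e) (\<lambda>d. play S (h @ [(e, d)]) (take k es)))
      = bind_pmf (S h e) (\<lambda>d. game S (h @ [(e, d)]) (R - {e}) k)" for e
    unfolding game_def by (rule bind_commute_pmf)
  then show ?thesis
    by (simp add: game_def[of S h] random_permutation_of_set[OF assms] bind_assoc_pmf bind_return_pmf)
qed

lemma set_pmf_play:
  "h' \<in> set_pmf (play S h es) \<Longrightarrow> take (length h) h' = h \<and> map fst h' = map fst h @ es"
proof (induction es arbitrary: h)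
  case (Cons e es)
  then obtain d where "h' \<in> set_pmf (play S (h @ [(e, d)]) es)" by auto
  from Cons.IH[OF this] have *: "take (Suc (length h)) h' = h @ [(e, d)]"
    "map fst h' = map fst h @ e # es" by auto
  from arg_cong[OF *(1), of "take (length h)"] have "take (length h) h' = h"
    by (simp add: min_def)
  with * show ?case by simp
qed simp

lemma set_pmf_game:
  assumes "h' \<in> set_pmf (game S h R k)" "finite R"
  obtains es where "take (length h) h' = h" "map fst h' = map fst h @ es" "set es \<subseteq> R" "distinct es"
proof -
  from assms obtain es where es: "es \<in> permutations_of_set R" "h' \<in> set_pmf (play S h (take k es))"
    by (auto simp: game_def)
  then have "set (take k es) \<subseteq> R" "distinct (take k es)"
    by (auto dest: permutations_of_setD in_set_takeD)
  with set_pmf_play[OF es(2)] that show thesis by blast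
qed

text \<open>\<open>P\<close> is tested on the history strictly before \<open>f\<close>, so neither
  \<open>f\<close> nor the decision on it can make \<open>P\<close> true.\<close>

definition presented_after :: "(history \<Rightarrow> bool) \<Rightarrow> nat set \<Rightarrow> history \<Rightarrow> bool" where
  "presented_after P f h \<longleftrightarrow> (\<exists>i<length h. fst (h ! i) = f \<and> P (take i h))"

text \<open>The strategy cannot foresee the order. If \<open>P\<close> first holds after
  \<open>s\<close> rounds and \<open>f\<close> is still to come, then \<open>f\<close> is presented
  in the remaining rounds with conditional probability \<open>(k - s) / (card R - s)\<close>, which
  is at most \<open>k / card R\<close>. The induction on \<open>k\<close> conditions on the next
  edge.\<close>

lemma prob_presented_after_game:
  assumes mono: "\<And>h h'. P h \<Longrightarrow> P (h @ h')"
    and "finite R" "f \<in> R" "f \<notin> fst ` set h" "k \<le> card R"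
  shows "measure_pmf.prob (game S h R k) {h'. presented_after P f h'}
    \<le> real k / real (card R) * measure_pmf.prob (game S h R k) {h'. P h'}"
  using assms(2-)
proof (induction k arbitrary: h R)
  case 0
  then have "fst (h ! i) \<noteq> f" if "i < length h" for i
    using nth_mem[OF that] by blast
  then have "\<not> presented_after P f h" by (auto simp: presented_after_def)
  then show ?case by simp
next
  case (Suc k)
  let ?pr = "\<lambda>e d X. measure_pmf.prob (game S (h @ [(e, d)]) (R - {e}) k) X"
  let ?Q = "{h'. presented_after P f h'}" and ?P = "{h'. P h'}"
  let ?m = "card R"
  \<comment> \<open>\<open>E e X\<close> is the probability of \<open>X\<close> given that
    \<open>e\<close> is the next edge.\<close>
  define E where "E e X = measure_pmf.expectation (S h e) (\<lambda>d. ?pr e d X)" for e X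
  have R: "R \<noteq> {}" "?m > 0" using Suc.prems by (auto simp: card_gt_0_iff)
  have step: "measure_pmf.prob (game S h R (Suc k)) X = (\<Sum>e\<in>R. E e X) / ?m" for X
    unfolding game_Suc[OF Suc.prems(1) R(1)] prob_bind_pmf
    by (subst integral_pmf_of_set[OF R(1) Suc.prems(1)]) (simp add: E_def prob_bind_pmf)
  have fin: "integrable (measure_pmf (S h e)) g" for e and g :: "bool \<Rightarrow> real"
    by (rule integrable_measure_pmf_finite) simp
  have E_le1: "E e X \<le> 1" for e X
    unfolding E_def by (intro measure_pmf.integral_le_const fin) auto
  have E_f: "E f ?Q \<le> of_bool (P h)"
  proof (cases "P h")
    case False
    have "?pr f d ?Q = 0" for d
    proof (subst measure_pmf_zero_iff, rule equals0I)
      fix h' assume "h' \<in> set_pmf (game S (h @ [(f, d)]) (R - {f}) k) \<inter> ?Q"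
      then have h': "h' \<in> set_pmf (game S (h @ [(f, d)]) (R - {f}) k)" "presented_after P f h'"
        by auto
      obtain es where "take (length (h @ [(f, d)])) h' = h @ [(f, d)]"
        "map fst h' = map fst (h @ [(f, d)]) @ es" "set es \<subseteq> R - {f}"
        by (rule set_pmf_game[OF h'(1)]) (use Suc.prems(1) in simp)
      then have es: "take (Suc (length h)) h' = h @ [(f, d)]" "map fst h' = map fst h @ f # es"
        "set es \<subseteq> R - {f}" by simp_all
      from h'(2) obtain i where i: "i < length h'" "fst (h' ! i) = f" "P (take i h')"
        by (auto simp: presented_after_def)
      have nth: "(map fst h @ f # es) ! i = f" "i < length (map fst h @ f # es)"
        using i(1,2) by (simp_all flip: es(2))
      \<comment> \<open>The past avoids \<open>f\<close>, and all later edges come from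
        \<open>R - {f}\<close>, so \<open>f\<close> occurs only here, where the tested history is
        \<open>h\<close> itself.\<close>
      have "i = length h"
      proof (rule ccontr)
        assume "i \<noteq> length h"
        then consider "i < length h" | "i > length h" by linarith
        then show False
        proof cases
          case 1
          then have "f = fst (h ! i)" using nth by (simp add: nth_append)
          then show False using Suc.prems(3) nth_mem[OF 1] by blast
        next
          case 2
          then obtain l where "i = Suc (length h + l)" using less_imp_Suc_add by blast
          then have "es ! l = f" "l < length es" using nth by (auto simp: nth_append)
          then show False using es(3) nth_mem[of l es] by blast
        qed
      qed
      then have "take i h' = h" using arg_cong[OF es(1), of "take (length h)"] by (simp add: min_def)
      with i(3) False show False by simp
    qed
    then show ?thesis using False by (simp add: E_def)
  qed (use E_le1 in simp)
  have E_nonneg: "E e X \<ge> 0" for e X unfolding E_def by (intro Bochner_Integration.integral_nonneg) auto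
  have E_ne: "E e ?Q \<le> real k / (?m - 1) * E e ?P" if e: "e \<in> R" "e \<noteq> f" for e
  proof -
    have "?pr e d ?Q \<le> real k / real (card (R - {e})) * ?pr e d ?P" for d
      using Suc.prems e by (intro Suc.IH) auto
    then have "E e ?Q \<le> measure_pmf.expectation (S h e) (\<lambda>d. real k / real (card (R - {e})) * ?pr e d ?P)"
      unfolding E_def by (intro integral_mono fin)
    also have "\<dots> = real k / (?m - 1) * E e ?P"
      using e Suc.prems(1) R by (simp add: E_def of_nat_diff)
    finally show ?thesis .
  qed
  have sum_Q: "(\<Sum>e\<in>R. E e ?Q) \<le> of_bool (P h) + real k / (?m - 1) * (\<Sum>e\<in>R - {f}. E e ?P)"
    unfolding sum.remove[OF Suc.prems(1,2)] sum_distrib_left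
    by (intro add_mono E_f sum_mono E_ne) auto
  have "(\<Sum>e\<in>R. E e ?Q) \<le> real (Suc k) / ?m * (\<Sum>e\<in>R. E e ?P)"
  proof (cases "P h")
    \<comment> \<open>By monotonicity \<open>P\<close> is now certain, so both sides become
      explicit: the right one equals \<open>1 + k\<close>.\<close>
    case True
    have "?pr e d ?P = 1" if "e \<in> R" for e d
    proof (subst measure_pmf.prob_eq_1)
      have "P h'" if "h' \<in> set_pmf (game S (h @ [(e, d)]) (R - {e}) k)" for h'
      proof -
        have "take (length (h @ [(e, d)])) h' = h @ [(e, d)]"
          by (rule set_pmf_game[OF that]) (use Suc.prems(1) in simp_all)
        then have "h' = h @ ((e, d) # drop (Suc (length h)) h')"
          using append_take_drop_id[of "Suc (length h)" h'] by (simp del: append_take_drop_id)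
        then show ?thesis using mono[OF True] by metis
      qed
      then show "AE h' in game S (h @ [(e, d)]) (R - {e}) k. h' \<in> ?P" by (simp add: AE_measure_pmf_iff)
    qed simp
    then have P1: "E e ?P = 1" if "e \<in> R" for e using that by (simp add: E_def)
    have "(\<Sum>e\<in>R. E e ?P) = ?m" using P1 by simp
    moreover have "(\<Sum>e\<in>R - {f}. E e ?P) = real ?m - 1"
      using P1 Suc.prems R by (simp add: of_nat_diff)
    moreover have "real k / (?m - 1) * (real ?m - 1) \<le> real k"
      using R by (cases "?m = 1") (auto simp: of_nat_diff)
    ultimately have "(\<Sum>e\<in>R. E e ?Q) \<le> 1 + real k" using sum_Q True by simp
    with \<open>(\<Sum>e\<in>R. E e ?P) = ?m\<close> R show ?thesis by simp
  next
    case False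
    \<comment> \<open>Here \<open>Suc k \<le> ?m\<close> enters; for \<open>?m = 1\<close> the left
      side is 0 by division by zero.\<close>
    have "real k / (?m - 1) \<le> real (Suc k) / ?m"
    proof (cases "?m = 1")
      case False
      then have "?m > 1" using R by simp
      then show ?thesis using Suc.prems(4) by (simp add: divide_simps algebra_simps of_nat_diff)
    qed simp
    then have "real k / (?m - 1) * (\<Sum>e\<in>R - {f}. E e ?P) \<le> real (Suc k) / ?m * (\<Sum>e\<in>R. E e ?P)"
      using Suc.prems by (intro mult_mono sum_mono2 sum_nonneg E_nonneg) auto
    with sum_Q False show ?thesis by simp
  qed
  then show ?case using R unfolding step by (simp add: divide_simps)
qed

subsection \<open>Clusters\<close>

type_synonym clusters = "(nat set \<times> nat) set"

definition sized :: "clusters \<Rightarrow> nat \<Rightarrow> nat \<Rightarrow> nat set set" where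
  "sized Z k m = {U. (U, m) \<in> Z \<and> card U = k}"

text \<open>A cluster \<open>(U, m)\<close> is a vertex set \<open>U\<close> that was connected by \<open>m\<close> purchased edges at some time.
  It is kept when \<open>U\<close> receives further edges, so that all counts are monotone in time and the same
  \<open>U\<close> may occur with several values of \<open>m\<close>.\<close>

definition grow_step :: "nat set \<Rightarrow> clusters \<Rightarrow> clusters" where
  "grow_step e Z = {(U, Suc m) |U m. (U, m) \<in> Z \<and> e \<subseteq> U}"

locale cluster_process =
  fixes V :: "nat set" and r R :: nat and T :: "nat \<Rightarrow> nat \<Rightarrow> real"
  assumes finite_V: "finite V"
begin

definition alive :: "clusters \<Rightarrow> nat \<Rightarrow> bool" where
  "alive Z x \<longleftrightarrow> (\<forall>k\<le>r. \<forall>m\<le>R. real (card {U \<in> sized Z k m. x \<in> U}) \<le> T k m)"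

text \<open>Liveness is asked of the endpoints of \<open>e\<close> only, in the state before
  \<open>e\<close> is added: every merged pair consists of one cluster through each endpoint, so
  this already bounds their number.\<close>

definition join_step :: "nat set \<Rightarrow> clusters \<Rightarrow> clusters" where
  "join_step e Z = {(U \<union> W, Suc (i + j)) |U W i j. (U, i) \<in> Z \<and> (W, j) \<in> Z \<and> U \<inter> W = {} \<and>
     (\<exists>x\<in>U. \<exists>y\<in>W. e = {x, y} \<and> alive Z x \<and> alive Z y)}"

definition cluster_step :: "clusters \<Rightarrow> nat set \<times> bool \<Rightarrow> clusters" where
  "cluster_step Z ed =
     (if snd ed then Z \<union> grow_step (fst ed) Z \<union> join_step (fst ed) Z else Z)"

definition clusters :: "history \<Rightarrow> clusters" where
  "clusters h = foldl cluster_step ((\<lambda>x. ({x}, 0)) ` V) h"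

text \<open>Collecting the merges by time of purchase lets the budget bound the number of
  contributions.\<close>

definition joined :: "history \<Rightarrow> clusters" where
  "joined h = (\<Union>i\<in>{i. i < length h \<and> snd (h ! i)}. join_step (fst (h ! i)) (clusters (take i h)))"

lemma clusters_Nil [simp]: "clusters [] = (\<lambda>x. ({x}, 0)) ` V"
  by (simp add: clusters_def)

lemma clusters_snoc [simp]: "clusters (h @ [ed]) = cluster_step (clusters h) ed"
  by (simp add: clusters_def)

lemma clusters_mono: "clusters h \<subseteq> clusters (h @ h')"
  by (induction h' rule: rev_induct)
     (auto simp: cluster_step_def simp flip: append_assoc)

lemma clusters_verts: "(U, m) \<in> clusters h \<Longrightarrow> U \<subseteq> V"
  by (induction h arbitrary: U m rule: rev_induct)
     (fastforce simp: cluster_step_def grow_step_def join_step_def split: if_splits)+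

lemma finite_sized: "finite (sized (clusters h) k m)"
  by (rule finite_subset[of _ "Pow V"]) (auto simp: sized_def finite_V dest: clusters_verts)

text \<open>Clusters are never removed, so the counts only grow and a dead vertex stays dead. Hence
  liveness at the end gives liveness at every earlier merge.\<close>

lemma alive_antimono:
  assumes "alive (clusters (h @ h')) x"
  shows "alive (clusters h) x"
  unfolding alive_def
proof (intro allI impI)
  fix k m assume "k \<le> r" "m \<le> R"
  have "card {U \<in> sized (clusters h) k m. x \<in> U} \<le> card {U \<in> sized (clusters (h @ h')) k m. x \<in> U}"
    using clusters_mono[of h h']
    by (intro card_mono finite_subset[OF _ finite_sized[of "h @ h'" k m]]) (auto simp: sized_def)
  with assms \<open>k \<le> r\<close> \<open>m \<le> R\<close> show "real (card {U \<in> sized (clusters h) k m. x \<in> U}) \<le> T k m"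
    unfolding alive_def by (meson of_nat_le_iff order_trans)
qed

lemma clusters_0: "(U, 0) \<in> clusters h \<longleftrightarrow> (\<exists>x\<in>V. U = {x})"
  by (induction h rule: rev_induct) (auto simp: cluster_step_def grow_step_def join_step_def)

lemma joined_snoc:
  "joined (h @ [ed]) = joined h \<union> (if snd ed then join_step (fst ed) (clusters h) else {})"
proof -
  have "{i. i < length (h @ [ed]) \<and> snd ((h @ [ed]) ! i)} =
      {i. i < length h \<and> snd (h ! i)} \<union> (if snd ed then {length h} else {})"
    by (auto simp: nth_append less_Suc_eq)
  then show ?thesis by (auto simp: joined_def nth_append)
qed

text \<open>Splits clusters by origin, since the two kinds are counted differently: merges by the
  budget, edges inside an existing \<open>U\<close> by the random order. For the latter only the
  presentation of the edge is recorded, which suffices for an upper bound.\<close>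

lemma clusters_Suc:
  "(U, Suc m) \<in> clusters h \<Longrightarrow> (U, Suc m) \<in> joined h \<or>
     (\<exists>f\<subseteq>U. presented_after (\<lambda>h. (U, m) \<in> clusters h) f h)"
proof (induction h rule: rev_induct)
  case (snoc ed h)
  from snoc.prems consider "(U, Suc m) \<in> clusters h" | "snd ed" "(U, Suc m) \<in> grow_step (fst ed) (clusters h)"
    | "snd ed" "(U, Suc m) \<in> join_step (fst ed) (clusters h)"
    by (auto simp: cluster_step_def split: if_splits)
  then show ?case
  proof cases
    case 1
    from snoc.IH[OF this] show ?thesis
      by (auto simp: joined_snoc presented_after_def nth_append)
  next
    case 2
    then have "fst ed \<subseteq> U" "(U, m) \<in> clusters h" by (auto simp: grow_step_def)
    then have "presented_after (\<lambda>h. (U, m) \<in> clusters h) (fst ed) (h @ [ed])"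
      unfolding presented_after_def by (intro exI[of _ "length h"]) simp
    with \<open>fst ed \<subseteq> U\<close> show ?thesis by blast
  next
    case 3
    then show ?thesis by (simp add: joined_snoc)
  qed
qed auto

text \<open>An alive endpoint \<open>x\<close> lies in at most \<open>T i j\<close> clusters with
  \<open>i\<close> vertices and \<open>j\<close> edges, and the cluster of \<open>y\<close> must
  supply the remaining \<open>k - i\<close> vertices and \<open>m - j\<close> edges, because
  \<open>e\<close> itself is the last of the \<open>Suc m\<close> edges. Summing over the splittings
  gives the convolution.\<close>

lemma card_join_step:
  fixes h :: history and e :: "nat set"
  assumes "k \<le> r" "m \<le> R" and T: "\<And>k m. 0 \<le> T k m"
  shows "real (card (sized (join_step e (clusters h)) k (Suc m)))
    \<le> (\<Sum>i\<le>k. \<Sum>j\<le>m. T i j * T (k - i) (m - j))"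
proof (cases "\<exists>x y. e = {x, y} \<and> alive (clusters h) x \<and> alive (clusters h) y")
  case False
  then have "join_step e (clusters h) = {}" by (auto simp: join_step_def)
  then show ?thesis by (auto simp: sized_def intro!: sum_nonneg mult_nonneg_nonneg T)
next
  case True
  then obtain x y where xy: "e = {x, y}" "alive (clusters h) x" "alive (clusters h) y" by blast
  define A where "A z i j = {U \<in> sized (clusters h) i j. z \<in> U}" for z i j
  have fin: "finite (A z i j)" for z i j unfolding A_def by (simp add: finite_sized)
  have A_le: "real (card (A z i j)) \<le> T i j" if "z \<in> {x, y}" "i \<le> k" "j \<le> m" for z i j
    using that xy(2,3) assms(1,2) by (auto simp: alive_def A_def)
  let ?I = "{..k} \<times> {..m}"
  define B where "B ij = (case ij of (i, j) \<Rightarrow> (\<lambda>(U, W). U \<union> W) ` (A x i j \<times> A y (k - i) (m - j)))"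
    for ij
  have card_B: "finite (B ij)"
    "card (B ij) \<le> card (A x (fst ij) (snd ij)) * card (A y (k - fst ij) (m - snd ij))" for ij
    unfolding B_def case_prod_beta card_cartesian_product[symmetric]
    by (intro finite_imageI card_image_le finite_cartesian_product fin)+
  have sub: "sized (join_step e (clusters h)) k (Suc m) \<subseteq> (\<Union>ij\<in>?I. B ij)"
  proof
    fix X assume "X \<in> sized (join_step e (clusters h)) k (Suc m)"
    then obtain U W i j x' y' where X: "X = U \<union> W" "card X = k" "m = i + j"
      "(U, i) \<in> clusters h" "(W, j) \<in> clusters h" "U \<inter> W = {}" "x' \<in> U" "y' \<in> W" "e = {x', y'}"
      by (auto simp: sized_def join_step_def)
    have "finite U" "finite W" using X clusters_verts finite_V by (meson finite_subset)+
    then have k: "k = card U + card W" using X card_Un_disjoint by blast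
    \<comment> \<open>The witnesses of the merge may name the endpoints in the opposite order, which
      exchanges the roles of \<open>U\<close> and \<open>W\<close>.\<close>
    consider "x' = x" "y' = y" | "x' = y" "y' = x" using X(9) xy(1) by (auto simp: doubleton_eq_iff)
    then show "X \<in> (\<Union>ij\<in>?I. B ij)"
    proof cases
      case 1
      have "(U, W) \<in> A x (card U) i \<times> A y (k - card U) (m - i)"
        using X k 1 by (auto simp: A_def sized_def)
      then have "X \<in> B (card U, i)" using X(1) unfolding B_def by force
      moreover have "(card U, i) \<in> ?I" using X k by auto
      ultimately show ?thesis by blast
    next
      case 2
      have "(W, U) \<in> A x (card W) j \<times> A y (k - card W) (m - j)"
        using X k 2 by (auto simp: A_def sized_def)
      then have "X \<in> B (card W, j)" using X(1) unfolding B_def by force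
      moreover have "(card W, j) \<in> ?I" using X k by auto
      ultimately show ?thesis by blast
    qed
  qed
  have "card (sized (join_step e (clusters h)) k (Suc m)) \<le> card (\<Union>ij\<in>?I. B ij)"
    using sub by (intro card_mono finite_UN_I card_B) auto
  also have "\<dots> \<le> (\<Sum>ij\<in>?I. card (B ij))" by (rule card_UN_le) simp
  also have "\<dots> \<le> (\<Sum>ij\<in>?I. card (A x (fst ij) (snd ij)) * card (A y (k - fst ij) (m - snd ij)))"
    by (intro sum_mono card_B)
  finally have "real (card (sized (join_step e (clusters h)) k (Suc m)))
      \<le> (\<Sum>ij\<in>?I. real (card (A x (fst ij) (snd ij))) * real (card (A y (k - fst ij) (m - snd ij))))"
    by (simp flip: of_nat_mult of_nat_sum)
  also have "\<dots> \<le> (\<Sum>ij\<in>?I. T (fst ij) (snd ij) * T (k - fst ij) (m - snd ij))"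
    by (intro sum_mono mult_mono A_le T) auto
  finally show ?thesis by (simp add: sum.cartesian_product case_prod_beta)
qed

section \<open>Merges paid for by the budget\<close>

lemma card_purchased:
  assumes "distinct (map fst h)"
  shows "card {i. i < length h \<and> snd (h ! i)} = card (purchased h)"
proof -
  have "bij_betw (\<lambda>i. fst (h ! i)) {i. i < length h \<and> snd (h ! i)} (purchased h)"
    unfolding bij_betw_def
  proof
    show "inj_on (\<lambda>i. fst (h ! i)) {i. i < length h \<and> snd (h ! i)}"
    proof (rule inj_onI)
      fix i j assume "i \<in> {i. i < length h \<and> snd (h ! i)}" "j \<in> {i. i < length h \<and> snd (h ! i)}"
        "fst (h ! i) = fst (h ! j)"
      then show "i = j" using assms nth_eq_iff_index_eq[of "map fst h" i j] by simp
    qed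
    show "(\<lambda>i. fst (h ! i)) ` {i. i < length h \<and> snd (h ! i)} = purchased h"
    proof (intro equalityI subsetI)
      fix e assume "e \<in> purchased h"
      then obtain i where "i < length h" "h ! i = (e, True)"
        by (auto simp: purchased_def in_set_conv_nth)
      then show "e \<in> (\<lambda>i. fst (h ! i)) ` {i. i < length h \<and> snd (h ! i)}" by force
    next
      fix e assume "e \<in> (\<lambda>i. fst (h ! i)) ` {i. i < length h \<and> snd (h ! i)}"
      then obtain i where "i < length h" "h ! i = (e, True)" by (auto simp: prod_eq_iff)
      then show "e \<in> purchased h" by (auto simp: purchased_def dest: nth_mem)
    qed
  qed
  then show ?thesis by (rule bij_betw_same_card)
qed

text \<open>A pointwise bound for every history without repeated edges: each purchase creates at
  most as many merged clusters as the convolution in \<open>card_join_step\<close> allows.\<close>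

lemma card_joined:
  fixes h :: history
  assumes "k \<le> r" "m \<le> R" and T: "\<And>k m. 0 \<le> T k m" and "distinct (map fst h)"
  shows "real (card (sized (joined h) k (Suc m)))
    \<le> real (card (purchased h)) * (\<Sum>i\<le>k. \<Sum>j\<le>m. T i j * T (k - i) (m - j))"
proof -
  let ?I = "{i. i < length h \<and> snd (h ! i)}"
  let ?J = "\<lambda>i. sized (join_step (fst (h ! i)) (clusters (take i h))) k (Suc m)"
  have "sized (joined h) k (Suc m) = (\<Union>i\<in>?I. ?J i)" by (auto simp: joined_def sized_def)
  then have "card (sized (joined h) k (Suc m)) \<le> (\<Sum>i\<in>?I. card (?J i))"
    using card_UN_le[of ?I ?J] by simp
  then have "real (card (sized (joined h) k (Suc m))) \<le> (\<Sum>i\<in>?I. real (card (?J i)))"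
    by (simp flip: of_nat_sum)
  also have "\<dots> \<le> of_nat (card ?I) * (\<Sum>i\<le>k. \<Sum>j\<le>m. T i j * T (k - i) (m - j))"
    by (intro sum_bounded_above card_join_step assms)
  finally show ?thesis using card_purchased[OF assms(4)] by simp
qed

lemma joined_verts: "(U, m) \<in> joined h \<Longrightarrow> U \<subseteq> V"
  by (auto simp: joined_def join_step_def dest!: clusters_verts)

end

subsection \<open>Cliques on alive vertices\<close>

lemma purchased_snoc:
  "purchased (h @ [ed]) = (if snd ed then insert (fst ed) (purchased h) else purchased h)"
  by (cases ed) (auto simp: purchased_def)

lemma purchased_subset: "purchased h \<subseteq> fst ` set h"
  by (force simp: purchased_def)

context cluster_process
begin

text \<open>The pieces of Kruskal's algorithm inside \<open>W\<close> are clusters with their current edge numbers.\<close>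

lemma clusters_partition:
  assumes "distinct (map fst h)" "\<forall>e\<in>fst ` set h. card e = 2"
    and "W \<subseteq> V" "\<forall>x\<in>W. alive (clusters h) x"
  shows "\<exists>\<P>. partition_on W \<P> \<and>
    (\<forall>U\<in>\<P>. (U, card {e \<in> purchased h. e \<subseteq> U}) \<in> clusters h) \<and>
    (\<forall>e\<in>purchased h. e \<subseteq> W \<longrightarrow> (\<exists>U\<in>\<P>. e \<subseteq> U))"
  using assms
proof (induction h rule: rev_induct)
  case Nil
  then show ?case
    by (intro exI[of _ "(\<lambda>x. {x}) ` W"]) (auto simp: purchased_def partition_on_def disjoint_def)
next
  case (snoc ed h)
  obtain e d where ed: "ed = (e, d)" by (cases ed)
  have alive: "\<forall>x\<in>W. alive (clusters h) x"
    using snoc.prems(4) alive_antimono by blast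
  have "distinct (map fst h)" "\<forall>e\<in>fst ` set h. card e = 2" using snoc.prems by auto
  from snoc.IH[OF this snoc.prems(3) alive] obtain \<P> where P: "partition_on W \<P>"
    "\<forall>U\<in>\<P>. (U, card {e \<in> purchased h. e \<subseteq> U}) \<in> clusters h"
    "\<forall>e\<in>purchased h. e \<subseteq> W \<longrightarrow> (\<exists>U\<in>\<P>. e \<subseteq> U)" by (elim exE conjE)
  have \<P>: "\<Union>\<P> = W" "{} \<notin> \<P>" "\<And>A B. A \<in> \<P> \<Longrightarrow> B \<in> \<P> \<Longrightarrow> A \<noteq> B \<Longrightarrow> A \<inter> B = {}"
    "\<And>U. U \<in> \<P> \<Longrightarrow> (U, card {e \<in> purchased h. e \<subseteq> U}) \<in> clusters h"
    "\<And>e. e \<in> purchased h \<Longrightarrow> e \<subseteq> W \<Longrightarrow> \<exists>U\<in>\<P>. e \<subseteq> U"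
    using P(2,3) partition_onD1[OF P(1)] partition_onD3[OF P(1)] disjointD[OF partition_onD2[OF P(1)]]
    by simp_all
  show ?case
  proof (cases d)
    case False
    then show ?thesis using P unfolding ed
      by (intro exI[of _ \<P>]) (simp add: purchased_snoc cluster_step_def)
  next
    case True
    have e_new: "e \<notin> purchased h" using snoc.prems(1) purchased_subset[of h] by (auto simp: ed)
    have fin: "finite (purchased h)" by (rule finite_subset[OF purchased_subset]) simp
    have pur: "purchased (h @ [ed]) = insert e (purchased h)" by (simp add: purchased_snoc ed True)
    have step: "clusters (h @ [ed]) = clusters h \<union> grow_step e (clusters h) \<union> join_step e (clusters h)"
      by (simp add: ed True cluster_step_def)
    have cnt_out: "{e' \<in> purchased (h @ [ed]). e' \<subseteq> U} = {e' \<in> purchased h. e' \<subseteq> U}"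
      if "\<not> e \<subseteq> U" for U using that by (auto simp: pur)
    have cnt_in: "card {e' \<in> purchased (h @ [ed]). e' \<subseteq> U} = Suc (card {e' \<in> purchased h. e' \<subseteq> U})"
      if "e \<subseteq> U" for U
    proof -
      have "{e' \<in> purchased (h @ [ed]). e' \<subseteq> U} = insert e {e' \<in> purchased h. e' \<subseteq> U}"
        using that by (auto simp: pur)
      then show ?thesis using e_new fin by simp
    qed
    have "card e = 2" using snoc.prems(2) by (simp add: ed)
    then obtain x y where xy: "e = {x, y}" "x \<noteq> y" by (auto simp: card_2_iff)
    show ?thesis
    proof (cases "\<exists>U\<in>\<P>. e \<subseteq> U")
      case inside: True
      \<comment> \<open>The partition is unchanged; \<open>grow_step\<close> records the additional
        edge of the piece containing \<open>e\<close>.\<close>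
      have "(U, card {e' \<in> purchased (h @ [ed]). e' \<subseteq> U}) \<in> clusters (h @ [ed])" if "U \<in> \<P>" for U
        using \<P>(4)[OF that] cnt_out[of U] cnt_in[of U]
        by (cases "e \<subseteq> U") (auto simp: step grow_step_def simp del: clusters_snoc)
      moreover have "\<forall>e'\<in>purchased (h @ [ed]). e' \<subseteq> W \<longrightarrow> (\<exists>U\<in>\<P>. e' \<subseteq> U)"
        using inside \<P>(5) by (simp add: pur)
      ultimately show ?thesis using P(1) by (intro exI[of _ \<P>]) simp
    next
      case not_inside: False
      show ?thesis
      proof (cases "e \<subseteq> W")
        case False
        have "(U, card {e' \<in> purchased (h @ [ed]). e' \<subseteq> U}) \<in> clusters (h @ [ed])" if "U \<in> \<P>" for U
          using \<P>(4)[OF that] cnt_out[of U] not_inside that by (auto simp: step simp del: clusters_snoc)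
        moreover have "\<forall>e'\<in>purchased (h @ [ed]). e' \<subseteq> W \<longrightarrow> (\<exists>U\<in>\<P>. e' \<subseteq> U)"
          using False \<P>(5) by (simp add: pur)
        ultimately show ?thesis using P(1) by (intro exI[of _ \<P>]) simp
      next
        case True
        then obtain A B where AB: "A \<in> \<P>" "x \<in> A" "B \<in> \<P>" "y \<in> B" using \<P>(1) xy by auto
        have "A \<noteq> B" using not_inside AB xy by blast
        then have disj: "A \<inter> B = {}" using \<P>(3) AB by blast
        let ?\<Q> = "insert (A \<union> B) (\<P> - {A, B})"
        \<comment> \<open>An earlier purchased edge within \<open>W\<close> already lies in one
          piece, so before \<open>e\<close> no edge crosses between \<open>A\<close> and
          \<open>B\<close>.\<close>
        have inner: "e' \<subseteq> A \<or> e' \<subseteq> B" if e': "e' \<in> purchased h" "e' \<subseteq> A \<union> B" for e'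
        proof -
          from e' AB \<P>(1) have "e' \<subseteq> W" by blast
          with \<P>(5) e'(1) obtain U where U: "U \<in> \<P>" "e' \<subseteq> U" by blast
          have "card e' = 2" using snoc.prems(2) purchased_subset[of h] e'(1) by auto
          then obtain z where "z \<in> e'" by (metis card.empty ex_in_conv zero_neq_numeral)
          then have "z \<in> U" "z \<in> A \<or> z \<in> B" using U e' by auto
          then have "U = A \<or> U = B" using \<P>(3)[OF U(1)] AB by blast
          with U(2) show ?thesis by blast
        qed
        let ?c = "\<lambda>U. card {e' \<in> purchased h. e' \<subseteq> U}"
        have "{e' \<in> purchased h. e' \<subseteq> A \<union> B} = {e' \<in> purchased h. e' \<subseteq> A} \<union> {e' \<in> purchased h. e' \<subseteq> B}"
          using inner by auto
        moreover have "{e' \<in> purchased h. e' \<subseteq> A} \<inter> {e' \<in> purchased h. e' \<subseteq> B} = {}"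
        proof (rule equals0I)
          fix e' assume "e' \<in> {e' \<in> purchased h. e' \<subseteq> A} \<inter> {e' \<in> purchased h. e' \<subseteq> B}"
          then have "e' = {}" "e' \<in> fst ` set h" using disj purchased_subset[of h] by auto
          then show False using snoc.prems(2) by fastforce
        qed
        ultimately have "?c (A \<union> B) = ?c A + ?c B" using fin by (simp add: card_Un_disjoint)
        \<comment> \<open>The edges of the merged piece are those of \<open>A\<close>, those of
          \<open>B\<close> and \<open>e\<close>, matching \<open>Suc (i + j)\<close> in
          \<open>join_step\<close>.\<close>
        then have "card {e' \<in> purchased (h @ [ed]). e' \<subseteq> A \<union> B} = Suc (?c A + ?c B)"
          using cnt_in[of "A \<union> B"] AB xy by simp
        moreover have "(A \<union> B, Suc (?c A + ?c B)) \<in> join_step e (clusters h)"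
        proof -
          have "alive (clusters h) x" "alive (clusters h) y" using alive True xy by auto
          then show ?thesis unfolding join_step_def using \<P>(4) AB disj xy by blast
        qed
        ultimately have "(A \<union> B, card {e' \<in> purchased (h @ [ed]). e' \<subseteq> A \<union> B}) \<in> clusters (h @ [ed])"
          by (simp add: step del: clusters_snoc)
        moreover have "(U, card {e' \<in> purchased (h @ [ed]). e' \<subseteq> U}) \<in> clusters (h @ [ed])"
          if "U \<in> \<P> - {A, B}" for U
          using \<P>(4) cnt_out[of U] not_inside that by (auto simp: step simp del: clusters_snoc)
        moreover have "\<forall>e'\<in>purchased (h @ [ed]). e' \<subseteq> W \<longrightarrow> (\<exists>U\<in>?\<Q>. e' \<subseteq> U)"
        proof (intro ballI impI)
          fix e' assume e': "e' \<in> purchased (h @ [ed])" "e' \<subseteq> W"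
          show "\<exists>U\<in>?\<Q>. e' \<subseteq> U"
          proof (cases "e' = e")
            case False
            then obtain U where "U \<in> \<P>" "e' \<subseteq> U" using e' \<P>(5) pur by blast
            then show ?thesis by (cases "U \<in> {A, B}") auto
          qed (use AB xy in auto)
        qed
        moreover have "\<Union>?\<Q> = W" using \<P>(1) AB by blast
        moreover have "{} \<notin> ?\<Q>" using \<P>(2) AB by blast
        moreover have "U \<inter> U' = {}" if "U \<in> ?\<Q>" "U' \<in> ?\<Q>" "U \<noteq> U'" for U U'
          using that \<P>(3) AB by blast
        ultimately show ?thesis
          by (intro exI[of _ ?\<Q>]) (auto simp: partition_on_def disjoint_def simp del: Un_iff)
      qed
    qed
  qed
qed

text \<open>One vertex of the clique is joined to all others by purchased edges, so the Kruskal
  partition of \<open>W\<close> has a single block, whose edge count is the number of pairs in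
  \<open>W\<close>.\<close>

lemma clique_cluster:
  assumes "distinct (map fst h)" "\<forall>e\<in>fst ` set h. card e = 2"
    and "W \<subseteq> V" "\<forall>x\<in>W. alive (clusters h) x" "W \<noteq> {}"
    and clique: "\<And>e. e \<subseteq> W \<Longrightarrow> card e = 2 \<Longrightarrow> e \<in> purchased h"
  shows "(W, card W choose 2) \<in> clusters h"
proof -
  from clusters_partition[OF assms(1-4)] obtain \<P> where P: "partition_on W \<P>"
    "\<forall>U\<in>\<P>. (U, card {e \<in> purchased h. e \<subseteq> U}) \<in> clusters h"
    "\<forall>e\<in>purchased h. e \<subseteq> W \<longrightarrow> (\<exists>U\<in>\<P>. e \<subseteq> U)" by (elim exE conjE)
  have \<P>: "\<Union>\<P> = W" "{} \<notin> \<P>" "\<And>A B. A \<in> \<P> \<Longrightarrow> B \<in> \<P> \<Longrightarrow> A \<noteq> B \<Longrightarrow> A \<inter> B = {}"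
    "\<And>U. U \<in> \<P> \<Longrightarrow> (U, card {e \<in> purchased h. e \<subseteq> U}) \<in> clusters h"
    "\<And>e. e \<in> purchased h \<Longrightarrow> e \<subseteq> W \<Longrightarrow> \<exists>U\<in>\<P>. e \<subseteq> U"
    using P(2,3) partition_onD1[OF P(1)] partition_onD3[OF P(1)] disjointD[OF partition_onD2[OF P(1)]]
    by simp_all
  obtain x where "x \<in> W" using \<open>W \<noteq> {}\<close> by blast
  then obtain U where U: "U \<in> \<P>" "x \<in> U" using \<P>(1) by blast
  have "y \<in> U" if y: "y \<in> W" for y
  proof (cases "y = x")
    case False
    then have "{x, y} \<in> purchased h" using y \<open>x \<in> W\<close> by (intro clique) auto
    then obtain U' where "U' \<in> \<P>" "{x, y} \<subseteq> U'" using \<P>(5) y \<open>x \<in> W\<close> by blast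
    then show ?thesis using \<P>(3)[of U U'] U by blast
  qed (use U in simp)
  then have "U = W" using U \<P>(1) by blast
  have "{e \<in> purchased h. e \<subseteq> W} = {e. e \<subseteq> W \<and> card e = 2}"
    using clique assms(2) purchased_subset[of h] by auto
  then have "card {e \<in> purchased h. e \<subseteq> W} = card W choose 2"
    using n_subsets[of W 2] assms(3) finite_V finite_subset by metis
  then show ?thesis using \<P>(4)[OF U(1)] \<open>U = W\<close> by simp
qed

section \<open>Dead vertices and disjoint cliques\<close>

lemma sum_card_sized:
  "(\<Sum>x\<in>V. card {U \<in> sized (clusters h) k m. x \<in> U}) = k * card (sized (clusters h) k m)"
proof -
  let ?S = "sized (clusters h) k m"
  have "(\<Sum>x\<in>V. card {U \<in> ?S. x \<in> U}) = (\<Sum>x\<in>V. \<Sum>U\<in>?S. of_bool (x \<in> U))"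
    by (intro sum.cong refl) (simp add: finite_sized Int_def)
  also have "\<dots> = (\<Sum>U\<in>?S. \<Sum>x\<in>V. of_bool (x \<in> U))" by (rule sum.swap)
  also have "\<dots> = (\<Sum>U\<in>?S. k)"
  proof (intro sum.cong refl)
    fix U assume U: "U \<in> ?S"
    then have "{x \<in> V. x \<in> U} = U" using clusters_verts by (auto simp: sized_def)
    then show "(\<Sum>x\<in>V. of_bool (x \<in> U)) = k" using U by (simp add: finite_V Int_def sized_def)
  qed
  finally show ?thesis by simp
qed

text \<open>A dead vertex exceeds some threshold, so one of its quotients of count and threshold is
  at least 1, as in Markov's inequality. Summing the quotients over all vertices counts every
  cluster \<open>k\<close> times.\<close>

lemma card_not_alive:
  assumes T: "\<And>k m. 0 < T k m"
  shows "real (card {x \<in> V. \<not> alive (clusters h) x})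
    \<le> (\<Sum>k\<le>r. \<Sum>m\<le>R. real k * real (card (sized (clusters h) k m)) / T k m)"
proof -
  let ?S = "sized (clusters h)"
  let ?D = "{x \<in> V. \<not> alive (clusters h) x}"
  let ?w = "\<lambda>x k m. real (card {U \<in> ?S k m. x \<in> U}) / T k m"
  have "real (card ?D) = (\<Sum>x\<in>?D. 1)" by simp
  also have "\<dots> \<le> (\<Sum>x\<in>?D. \<Sum>k\<le>r. \<Sum>m\<le>R. ?w x k m)"
  proof (rule sum_mono)
    fix x assume "x \<in> ?D"
    then obtain k m where km: "k \<le> r" "m \<le> R" "T k m < real (card {U \<in> ?S k m. x \<in> U})"
      by (auto simp: alive_def not_le)
    have nonneg: "0 \<le> ?w x k m" for k m using T by (simp add: less_imp_le)
    have "1 \<le> ?w x k m" using km(3) T[of k m] by simp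
    also have "\<dots> \<le> (\<Sum>m\<le>R. ?w x k m)" using km(2) nonneg by (intro member_le_sum) auto
    also have "\<dots> \<le> (\<Sum>k\<le>r. \<Sum>m\<le>R. ?w x k m)"
      using km(1) nonneg by (intro member_le_sum[of k "{..r}" "\<lambda>k. \<Sum>m\<le>R. ?w x k m"]) (auto intro!: sum_nonneg)
    finally show "1 \<le> (\<Sum>k\<le>r. \<Sum>m\<le>R. ?w x k m)" .
  qed
  also have "\<dots> \<le> (\<Sum>x\<in>V. \<Sum>k\<le>r. \<Sum>m\<le>R. ?w x k m)"
    using T finite_V by (intro sum_mono2) (auto intro!: sum_nonneg simp: less_imp_le)
  also have "\<dots> = (\<Sum>k\<le>r. \<Sum>m\<le>R. \<Sum>x\<in>V. ?w x k m)"
    by (subst sum.swap) (intro sum.cong refl sum.swap)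
  also have "\<dots> = (\<Sum>k\<le>r. \<Sum>m\<le>R. real k * real (card (?S k m)) / T k m)"
    by (simp flip: sum_divide_distrib of_nat_sum of_nat_mult add: sum_card_sized)
  finally show ?thesis .
qed

text \<open>A clique of alive vertices is a cluster by \<open>clique_cluster\<close>; every other
  one is charged to a dead vertex of its own.\<close>

lemma card_disjoint_cliques:
  assumes "distinct (map fst h)" "\<forall>e\<in>fst ` set h. card e = 2" "s \<ge> 1"
    and "finite C" and C: "\<And>W. W \<in> C \<Longrightarrow> W \<subseteq> V \<and> card W = s"
    and clique: "\<And>W e. W \<in> C \<Longrightarrow> e \<subseteq> W \<Longrightarrow> card e = 2 \<Longrightarrow> e \<in> purchased h"
    and disj: "\<And>W W'. W \<in> C \<Longrightarrow> W' \<in> C \<Longrightarrow> W \<noteq> W' \<Longrightarrow> W \<inter> W' = {}"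
  shows "card C \<le> card (sized (clusters h) s (s choose 2)) + card {x \<in> V. \<not> alive (clusters h) x}"
proof -
  let ?D = "{x \<in> V. \<not> alive (clusters h) x}"
  let ?C1 = "{W \<in> C. W \<inter> ?D = {}}" and ?C2 = "{W \<in> C. W \<inter> ?D \<noteq> {}}"
  have "?C1 \<subseteq> sized (clusters h) s (s choose 2)"
  proof
    fix W assume W: "W \<in> ?C1"
    then have "W \<noteq> {}" "W \<subseteq> V" "card W = s" using C[of W] \<open>s \<ge> 1\<close> by auto
    moreover from this W have "(W, card W choose 2) \<in> clusters h"
      using clique by (intro clique_cluster assms(1,2)) auto
    ultimately show "W \<in> sized (clusters h) s (s choose 2)" by (simp add: sized_def)
  qed
  then have 1: "card ?C1 \<le> card (sized (clusters h) s (s choose 2))"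
    by (intro card_mono finite_sized)
  \<comment> \<open>Disjoint cliques that contain a dead vertex contain distinct ones.\<close>
  define g where "g W = (SOME x. x \<in> W \<inter> ?D)" for W
  have g: "g W \<in> W \<inter> ?D" if "W \<in> ?C2" for W
    unfolding g_def using that by (intro someI_ex[of "\<lambda>x. x \<in> W \<inter> ?D"]) blast
  have "inj_on g ?C2"
  proof (rule inj_onI)
    fix W W' assume "W \<in> ?C2" "W' \<in> ?C2" "g W = g W'"
    then show "W = W'" using g[of W] g[of W'] disj[of W W'] by auto
  qed
  then have 2: "card ?C2 \<le> card ?D"
    using g finite_V by (intro card_inj_on_le[of g]) auto
  have "?C1 \<union> ?C2 = C" by blast
  from arg_cong[OF this, of card] have "card C \<le> card ?C1 + card ?C2"
    using card_Un_le[of ?C1 ?C2] by linarith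
  with 1 2 show ?thesis by linarith
qed

end

subsection \<open>Expected numbers of clusters\<close>

lemma pmf_expectation_mono:
  fixes f g :: "'a \<Rightarrow> real"
  assumes "finite (set_pmf M)" "\<And>x. x \<in> set_pmf M \<Longrightarrow> f x \<le> g x"
  shows "measure_pmf.expectation M f \<le> measure_pmf.expectation M g"
  using assms by (intro integral_mono_AE integrable_measure_pmf_finite) (auto simp: AE_measure_pmf_iff)

lemma pmf_expectation_card:
  assumes "finite (set_pmf M)" "finite A" "\<And>x. S x \<subseteq> A"
  shows "measure_pmf.expectation M (\<lambda>x. real (card (S x))) = (\<Sum>a\<in>A. measure_pmf.prob M {x. a \<in> S x})"
proof -
  have "real (card (S x)) = (\<Sum>a\<in>A. indicat_real {x. a \<in> S x} x)" for x
  proof -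
    have "(\<Sum>a\<in>A. indicat_real {x. a \<in> S x} x) = (\<Sum>a\<in>A. of_bool (a \<in> S x))"
      by (simp add: indicator_def)
    also have "\<dots> = real (card (S x))" using assms(2,3) by (simp add: Int_absorb1)
    finally show ?thesis by simp
  qed
  then have "measure_pmf.expectation M (\<lambda>x. real (card (S x))) =
      measure_pmf.expectation M (\<lambda>x. \<Sum>a\<in>A. indicat_real {x. a \<in> S x} x)" by simp
  also have "\<dots> = (\<Sum>a\<in>A. measure_pmf.expectation M (indicat_real {x. a \<in> S x}))"
    by (rule Bochner_Integration.integral_sum) (rule integrable_measure_pmf_finite[OF assms(1)])
  finally show ?thesis by simp
qed

lemma finite_set_pmf_game:
  assumes "finite R"
  shows "finite (set_pmf (game S h R k))"
proof -
  have "finite (set_pmf (play S h es))" for h es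
    by (induction es arbitrary: h) auto
  then show ?thesis using assms by (auto simp: game_def)
qed

text \<open>Reduces a factor to its vertex sets. Distinct copies are disjoint and, as
  \<open>r \<ge> 1\<close>, nonempty, so no two share a vertex set and the count is
  preserved.\<close>

lemma partial_factor_cliques:
  assumes "has_partial_factor \<alpha> (complete_ugraph r) (V, E)" "r \<ge> 1"
  obtains C where "finite C" "\<And>W. W \<in> C \<Longrightarrow> W \<subseteq> V \<and> card W = r"
    "\<And>W e. W \<in> C \<Longrightarrow> e \<subseteq> W \<Longrightarrow> card e = 2 \<Longrightarrow> e \<in> E"
    "\<And>W W'. W \<in> C \<Longrightarrow> W' \<in> C \<Longrightarrow> W \<noteq> W' \<Longrightarrow> W \<inter> W' = {}"
    "\<alpha> * real (card V) / real r \<le> real (card C)"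
proof -
  from assms(1) obtain C where C: "finite C" "\<And>H. H \<in> C \<Longrightarrow> subgraph H (V, E)"
    "\<And>H. H \<in> C \<Longrightarrow> graph_iso (complete_ugraph r) H" "disjoint_family_on verts C"
    "\<alpha> * real (card V) / real r \<le> real (card C)"
    unfolding has_partial_factor_def by (auto simp: complete_ugraph_def)
  have card: "card (verts H) = r" if H: "H \<in> C" for H
  proof -
    obtain f where "bij_betw f {1..r} (verts H)"
      using C(3)[OF H] by (auto simp: graph_iso_def complete_ugraph_def)
    from bij_betw_same_card[OF this] show ?thesis by simp
  qed
  have clique: "e \<in> E" if H: "H \<in> C" "e \<subseteq> verts H" "card e = 2" for H e
  proof -
    obtain f where f: "bij_betw f {1..r} (verts H)"
      "edges H = (\<lambda>e. f ` e) ` {e. e \<subseteq> {1..r} \<and> card e = 2}"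
      using C(3)[OF H(1)] by (auto simp: graph_iso_def complete_ugraph_def)
    \<comment> \<open>The preimage of \<open>e\<close> under the isomorphism is a pair, and every
      pair is an edge of the complete graph.\<close>
    define e' where "e' = {x \<in> {1..r}. f x \<in> e}"
    have "e \<subseteq> f ` {1..r}" using H(2) bij_betw_imp_surj_on[OF f(1)] by simp
    then have "f ` e' = e" unfolding e'_def by blast
    moreover have "inj_on f e'" by (rule inj_on_subset[OF bij_betw_imp_inj_on[OF f(1)]]) (auto simp: e'_def)
    ultimately have "card e' = 2" using H(3) card_image[of f e'] by simp
    moreover have "e' \<subseteq> {1..r}" by (auto simp: e'_def)
    ultimately have "e' \<in> {e. e \<subseteq> {1..r} \<and> card e = 2}" by simp
    then have "e \<in> edges H" using \<open>f ` e' = e\<close> unfolding f(2) by blast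
    then show ?thesis using C(2)[OF H(1)] by (auto simp: subgraph_def)
  qed
  have disj: "verts H \<inter> verts H' = {}" if "H \<in> C" "H' \<in> C" "H \<noteq> H'" for H H'
    using C(4) that by (auto simp: disjoint_family_on_def)
  have "inj_on verts C"
  proof (rule inj_onI, rule ccontr)
    fix H H' assume "H \<in> C" "H' \<in> C" "verts H = verts H'" "H \<noteq> H'"
    then have "verts H = {}" using disj[of H H'] by simp
    with card[OF \<open>H \<in> C\<close>] assms(2) show False by simp
  qed
  then have "card (verts ` C) = card C" by (rule card_image)
  moreover have "W \<subseteq> V \<and> card W = r" if W: "W \<in> verts ` C" for W
  proof -
    from W obtain H where "H \<in> C" "W = verts H" by blast
    then show ?thesis using card C(2) by (simp add: subgraph_def)
  qed
  moreover have "e \<in> E" if "W \<in> verts ` C" "e \<subseteq> W" "card e = 2" for W e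
    using that clique by blast
  moreover have "W \<inter> W' = {}" if "W \<in> verts ` C" "W' \<in> verts ` C" "W \<noteq> W'" for W W'
    using that disj by blast
  ultimately show thesis
    using C(1,5) by (intro that[of "verts ` C"]) simp_all
qed

text \<open>The recursion of \<open>coef\<close> mirrors the bound \<open>mean_Suc\<close> below: the first summand counts the edges
  inside a cluster, the second one the splittings of a merged cluster. The factor \<open>L\<close> is the ratio of
  the threshold to the bound on the mean number per vertex, and \<open>q ^ k / q\<close> stands for \<open>q ^ (k - 1)\<close> without truncation
  at \<open>k = 0\<close>.\<close>

primrec coef :: "real \<Rightarrow> nat \<Rightarrow> nat \<Rightarrow> nat \<Rightarrow> real" where
  "coef L r R 0 = 1"
| "coef L r R (Suc m) = real r ^ 2 * coef L r R m + real (r + 1) * real (R + 1) * (L * coef L r R m) ^ 2"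

lemma coef_pos: "r \<ge> 1 \<Longrightarrow> 0 < coef L r R m"
  by (induction m) (auto intro!: add_pos_nonneg mult_nonneg_nonneg)

lemma coef_mono: "r \<ge> 1 \<Longrightarrow> i \<le> j \<Longrightarrow> coef L r R i \<le> coef L r R j"
proof (rule lift_Suc_mono_le[of "coef L r R"])
  fix m assume r: "r \<ge> 1"
  have "1 * coef L r R m \<le> real r ^ 2 * coef L r R m"
    using r coef_pos[OF r, of L R m] by (intro mult_right_mono) auto
  also have "\<dots> \<le> coef L r R (Suc m)" by simp
  finally show "coef L r R m \<le> coef L r R (Suc m)" by simp
qed

definition threshold :: "real \<Rightarrow> nat \<Rightarrow> nat \<Rightarrow> real \<Rightarrow> real \<Rightarrow> nat \<Rightarrow> nat \<Rightarrow> real" where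
  "threshold L r R q p k m = L * coef L r R m * q ^ k * p ^ m / q"

text \<open>The powers of \<open>q\<close> and \<open>p\<close> multiply to
  \<open>q ^ k * p ^ m / q ^ 2\<close> for every splitting, and by monotonicity of
  \<open>coef\<close> one bound serves all of the at most \<open>(r + 1) * (R + 1)\<close>
  summands.\<close>

lemma threshold_convolution:
  assumes "r \<ge> 1" "L > 0" "q > 0" "p > 0" "k \<le> r" "m \<le> R"
  shows "(\<Sum>i\<le>k. \<Sum>j\<le>m. threshold L r R q p i j * threshold L r R q p (k - i) (m - j))
    \<le> real (r + 1) * real (R + 1) * (L * coef L r R m) ^ 2 * q ^ k * p ^ m / q ^ 2"
proof -
  let ?X = "(L * coef L r R m) ^ 2 * q ^ k * p ^ m / q ^ 2"
  have X: "?X \<ge> 0" using assms by simp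
  have "(\<Sum>i\<le>k. \<Sum>j\<le>m. threshold L r R q p i j * threshold L r R q p (k - i) (m - j))
      \<le> (\<Sum>i\<le>k. \<Sum>j\<le>m. ?X)"
  proof (intro sum_mono)
    fix i j assume "i \<in> {..k}" "j \<in> {..m}"
    then have ij: "i \<le> k" "j \<le> m" by auto
    have "q ^ k = q ^ i * q ^ (k - i)" "p ^ m = p ^ j * p ^ (m - j)"
      using ij by (simp_all flip: power_add)
    then have "threshold L r R q p i j * threshold L r R q p (k - i) (m - j) =
        (L * coef L r R j) * (L * coef L r R (m - j)) * (q ^ k * p ^ m / q ^ 2)"
      by (simp add: threshold_def power2_eq_square)
    also have "\<dots> \<le> (L * coef L r R m) * (L * coef L r R m) * (q ^ k * p ^ m / q ^ 2)"
      using assms ij coef_pos[of r L R]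
      by (intro mult_right_mono mult_mono coef_mono mult_left_mono) (auto simp: less_imp_le)
    finally show "threshold L r R q p i j * threshold L r R q p (k - i) (m - j) \<le> ?X"
      by (simp add: power2_eq_square)
  qed
  also have "\<dots> = (real (k + 1) * real (m + 1)) * ?X" by simp
  also have "\<dots> \<le> (real (r + 1) * real (R + 1)) * ?X"
    using assms by (intro mult_right_mono mult_mono X) auto
  finally show ?thesis by (simp add: mult.assoc)
qed

text \<open>With the budget written as \<open>real n * q * p\<close>, inner edges and merges
  contribute terms of the same order \<open>real n * q ^ k * p ^ m / q\<close> to the expected
  counts. The strategy enters only through the assumption \<open>budget\<close>.\<close>

locale builder_game =
  fixes n t r R :: nat and L q p :: real and S :: strategy
  assumes n: "n \<ge> 1" and r: "r \<ge> 1" and L: "L > 0" and q: "q > 0" and p: "p > 0"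
    and t_le: "t \<le> n choose 2" and p_eq: "p = real t / real (n choose 2)"
    and budget: "\<And>h. h \<in> set_pmf (game S [] (edges (complete_ugraph n)) t)
      \<Longrightarrow> real (card (purchased h)) \<le> real n * q * p"
begin

sublocale cluster_process "{1..n}" r R "threshold L r R q p"
  by unfold_locales simp

abbreviation "outcome \<equiv> game S [] (edges (complete_ugraph n)) t"

lemma finite_edges: "finite (edges (complete_ugraph n))"
  by (simp add: complete_ugraph_def)

lemma finite_outcome: "finite (set_pmf outcome)"
  by (rule finite_set_pmf_game) (rule finite_edges)

lemma card_edges: "card (edges (complete_ugraph n)) = n choose 2"
  using n_subsets[of "{1..n}" 2] by (simp add: complete_ugraph_def)

lemma outcome_distinct:
  assumes "h \<in> set_pmf outcome"
  shows "distinct (map fst h)" "fst ` set h \<subseteq> edges (complete_ugraph n)"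
    "\<forall>e\<in>fst ` set h. card e = 2"
proof -
  from set_pmf_game[OF assms finite_edges] show *: "distinct (map fst h)"
    and **: "fst ` set h \<subseteq> edges (complete_ugraph n)" by (metis append_Nil list.map(1) set_map)+
  then show "\<forall>e\<in>fst ` set h. card e = 2" by (auto simp: complete_ugraph_def)
qed

lemma threshold_pos: "0 < threshold L r R q p k m"
  using coef_pos[OF r] L q p by (simp add: threshold_def)

section \<open>Expected counts and their recursion\<close>

definition mean :: "nat \<Rightarrow> nat \<Rightarrow> real" where
  "mean k m = measure_pmf.expectation outcome (\<lambda>h. real (card (sized (clusters h) k m)))"

lemma mean_eq:
  "mean k m = (\<Sum>U | U \<subseteq> {1..n} \<and> card U = k. measure_pmf.prob outcome {h. (U, m) \<in> clusters h})"
proof -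
  have "sized (clusters h) k m \<subseteq> {U. U \<subseteq> {1..n} \<and> card U = k}" for h
    using clusters_verts by (auto simp: sized_def)
  then have "mean k m = (\<Sum>U | U \<subseteq> {1..n} \<and> card U = k. measure_pmf.prob outcome {h. U \<in> sized (clusters h) k m})"
    unfolding mean_def by (intro pmf_expectation_card finite_outcome) auto
  also have "\<dots> = (\<Sum>U | U \<subseteq> {1..n} \<and> card U = k. measure_pmf.prob outcome {h. (U, m) \<in> clusters h})"
    by (intro sum.cong refl) (auto simp: sized_def)
  finally show ?thesis .
qed

text \<open>The merge term holds for every outcome by \<open>card_joined\<close> and the budget. For
  the other term, each of the at most \<open>r ^ 2\<close> pairs inside a fixed \<open>U\<close> is
  presented after \<open>(U, m)\<close> became a cluster with probability at most \<open>p\<close>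
  times that of \<open>(U, m)\<close> becoming one; a union bound and summation over
  \<open>U\<close> give \<open>mean k m\<close>.\<close>

lemma mean_Suc:
  assumes "k \<le> r" "m \<le> R"
  shows "mean k (Suc m) \<le> real r ^ 2 * p * mean k m +
    real n * q * p * (\<Sum>i\<le>k. \<Sum>j\<le>m. threshold L r R q p i j * threshold L r R q p (k - i) (m - j))"
    (is "_ \<le> _ + ?J")
proof -
  let ?K = "{U. U \<subseteq> {1..n} \<and> card U = k}"
  let ?pa = "\<lambda>U f h. presented_after (\<lambda>h. (U, m) \<in> clusters h) f h"
  \<comment> \<open>\<open>G h\<close> contains the sets that may have grown: some pair inside
    \<open>U\<close> was presented when \<open>(U, m)\<close> was already a cluster.\<close>
  define G where "G h = {U \<in> ?K. \<exists>f\<in>{f. f \<subseteq> U \<and> card f = 2}. ?pa U f h}" for h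
  have finK: "finite ?K" by simp
  have finF: "finite {f. f \<subseteq> U \<and> card f = 2}" if "U \<in> ?K" for U
    using that finite_subset[of U "{1..n}"] by auto
  have "mean k (Suc m) \<le> measure_pmf.expectation outcome (\<lambda>h. ?J + real (card (G h)))"
    unfolding mean_def
  proof (intro pmf_expectation_mono finite_outcome)
    fix h assume h: "h \<in> set_pmf outcome"
    have "sized (clusters h) k (Suc m) \<subseteq> sized (joined h) k (Suc m) \<union> G h"
    proof
      fix U assume U: "U \<in> sized (clusters h) k (Suc m)"
      then have UK: "U \<in> ?K" "(U, Suc m) \<in> clusters h" using clusters_verts by (auto simp: sized_def)
      from clusters_Suc[OF UK(2)] show "U \<in> sized (joined h) k (Suc m) \<union> G h"
      proof
        assume "(U, Suc m) \<in> joined h"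
        then show ?thesis using UK by (simp add: sized_def)
      next
        assume "\<exists>f\<subseteq>U. ?pa U f h"
        then obtain f where f: "f \<subseteq> U" "?pa U f h" by blast
        from f(2) have "f \<in> fst ` set h" by (auto simp: presented_after_def)
        then have "card f = 2" using outcome_distinct(3)[OF h] by blast
        with f UK show ?thesis by (auto simp: G_def)
      qed
    qed
    moreover have "finite (sized (joined h) k (Suc m))"
      by (rule finite_subset[of _ ?K]) (use joined_verts in \<open>auto simp: sized_def\<close>)
    moreover have "finite (G h)" using finK by (simp add: G_def)
    ultimately have "card (sized (clusters h) k (Suc m)) \<le> card (sized (joined h) k (Suc m)) + card (G h)"
      by (meson card_Un_le card_mono finite_UnI le_trans)
    moreover have "real (card (sized (joined h) k (Suc m))) \<le> ?J"
    proof -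
      have "real (card (sized (joined h) k (Suc m))) \<le> real (card (purchased h)) *
          (\<Sum>i\<le>k. \<Sum>j\<le>m. threshold L r R q p i j * threshold L r R q p (k - i) (m - j))"
        using assms threshold_pos outcome_distinct(1)[OF h] by (intro card_joined) (auto simp: less_imp_le)
      also have "\<dots> \<le> ?J"
        using threshold_pos by (intro mult_right_mono budget h sum_nonneg mult_nonneg_nonneg) (auto simp: less_imp_le)
      finally show ?thesis .
    qed
    ultimately show "real (card (sized (clusters h) k (Suc m))) \<le> ?J + real (card (G h))" by linarith
  qed
  also have "\<dots> = ?J + measure_pmf.expectation outcome (\<lambda>h. real (card (G h)))"
    by (subst Bochner_Integration.integral_add) (auto intro!: integrable_measure_pmf_finite finite_outcome)
  also have "measure_pmf.expectation outcome (\<lambda>h. real (card (G h))) = (\<Sum>U\<in>?K. measure_pmf.prob outcome {h. U \<in> G h})"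
    by (intro pmf_expectation_card finite_outcome finK) (auto simp: G_def)
  also have "\<dots> \<le> (\<Sum>U\<in>?K. real r ^ 2 * p * measure_pmf.prob outcome {h. (U, m) \<in> clusters h})"
  proof (rule sum_mono)
    fix U assume U: "U \<in> ?K"
    let ?F = "{f. f \<subseteq> U \<and> card f = 2}" and ?P = "measure_pmf.prob outcome {h. (U, m) \<in> clusters h}"
    have "{h. U \<in> G h} = (\<Union>f\<in>?F. {h. ?pa U f h})" using U by (auto simp: G_def)
    then have "measure_pmf.prob outcome {h. U \<in> G h} \<le> (\<Sum>f\<in>?F. measure_pmf.prob outcome {h. ?pa U f h})"
      using finF[OF U] by (simp add: measure_pmf.finite_measure_subadditive_finite)
    also have "\<dots> \<le> (\<Sum>f\<in>?F. p * ?P)"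
    proof (rule sum_mono)
      fix f assume "f \<in> ?F"
      then have "f \<in> edges (complete_ugraph n)" using U by (auto simp: complete_ugraph_def)
      \<comment> \<open>The game starts with the empty history and all edges of the complete graph,
        so the ratio \<open>k / card R\<close> in \<open>prob_presented_after_game\<close> is
        \<open>p\<close>.\<close>
      then show "measure_pmf.prob outcome {h. ?pa U f h} \<le> p * ?P"
        using prob_presented_after_game[of "\<lambda>h. (U, m) \<in> clusters h" "edges (complete_ugraph n)" f "[]" t S]
          clusters_mono t_le finite_edges by (simp add: card_edges p_eq) blast
    qed
    also have "\<dots> = real (k choose 2) * (p * ?P)"
      using n_subsets[of U 2] U finite_subset[of U "{1..n}"] by simp
    also have "\<dots> \<le> real r ^ 2 * (p * ?P)"
    proof (rule mult_right_mono)
      have "k choose 2 \<le> k * (k - 1)" unfolding choose_two by simp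
      also have "\<dots> \<le> k ^ 2" by (simp add: power2_eq_square)
      also have "\<dots> \<le> r ^ 2" using assms(1) by (rule power_mono) simp
      finally show "real (k choose 2) \<le> real r ^ 2" by (simp flip: of_nat_power)
    qed (use p in simp)
    finally show "measure_pmf.prob outcome {h. U \<in> G h} \<le> real r ^ 2 * p * ?P" by (simp add: mult.assoc)
  qed
  also have "\<dots> = real r ^ 2 * p * mean k m" by (simp add: mean_eq sum_distrib_left)
  finally show ?thesis by simp
qed

text \<open>The factor \<open>q\<close> of the budget cancels one of the two divisions by
  \<open>q\<close> in the convolution, and the recursion of \<open>coef\<close> is exactly what the
  two terms of \<open>mean_Suc\<close> then add up to.\<close>

lemma mean_le:
  assumes "k \<le> r" "m \<le> R"
  shows "mean k m \<le> real n * coef L r R m * q ^ k * p ^ m / q"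
  using assms
proof (induction m)
  case 0
  \<comment> \<open>Without edges the clusters are the singletons; for \<open>k = 1\<close> the
    bound is attained because \<open>q ^ 1 / q = 1\<close>.\<close>
  have "sized (clusters h) k 0 = (if k = 1 then (\<lambda>x. {x}) ` {1..n} else {})" for h
    by (auto simp: sized_def clusters_0 simp del: One_nat_def)
  then have "mean k 0 = (if k = 1 then real n else 0)"
    by (simp add: mean_def card_image)
  then show ?case using q by simp
next
  case (Suc m)
  let ?c = "coef L r R m"
  have "mean k (Suc m) \<le> real r ^ 2 * p * mean k m + real n * q * p *
      (\<Sum>i\<le>k. \<Sum>j\<le>m. threshold L r R q p i j * threshold L r R q p (k - i) (m - j))"
    using Suc.prems by (intro mean_Suc) auto
  also have "\<dots> \<le> real r ^ 2 * p * (real n * ?c * q ^ k * p ^ m / q) + real n * q * p *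
      (real (r + 1) * real (R + 1) * (L * ?c) ^ 2 * q ^ k * p ^ m / q ^ 2)"
    using Suc q p L r by (intro add_mono mult_left_mono threshold_convolution) auto
  also have "\<dots> = real n * coef L r R (Suc m) * q ^ k * p ^ Suc m / q"
    using q by (simp add: field_simps power2_eq_square)
  finally show ?case .
qed

text \<open>Success with probability at least 1/2 forces at least
  \<open>\<alpha> * n / (2 * r)\<close> disjoint cliques in expectation. Their number is at most
  that of suitable clusters plus dead vertices, and both are bounded in expectation through
  \<open>mean_le\<close>.\<close>

lemma factor_inequality:
  assumes "\<alpha> > 0" "r \<ge> 2" "R = r choose 2"
    and success: "measure_pmf.prob (builder_graph n t S) {G. has_partial_factor \<alpha> (complete_ugraph r) G} \<ge> 1 / 2"
  shows "\<alpha> / (2 * real r) \<le> coef L r R R * q ^ r * p ^ R / q + real (r + 1) * real (R + 1) * real r / L"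
proof -
  let ?T = "threshold L r R q p"
  let ?A = "{h. has_partial_factor \<alpha> (complete_ugraph r) ({1..n}, purchased h)}"
  define N where "N h = real (card (sized (clusters h) r R)) +
    (\<Sum>k\<le>r. \<Sum>m\<le>R. real k * real (card (sized (clusters h) k m)) / ?T k m)" for h
  have N_nonneg: "0 \<le> N h" for h
    unfolding N_def using threshold_pos by (auto intro!: add_nonneg_nonneg sum_nonneg divide_nonneg_nonneg simp: less_imp_le)
  have "measure_pmf.prob outcome ?A \<ge> 1 / 2"
    using success unfolding builder_graph_eq_game by (simp add: vimage_def)
  then have "\<alpha> * real n / real r * (1 / 2) \<le> \<alpha> * real n / real r * measure_pmf.prob outcome ?A"
    using assms(1) by (intro mult_left_mono) auto
  also have "\<dots> = measure_pmf.expectation outcome (\<lambda>h. \<alpha> * real n / real r * indicat_real ?A h)" by simp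
  also have "\<dots> \<le> measure_pmf.expectation outcome N"
  proof (intro pmf_expectation_mono finite_outcome)
    fix h assume h: "h \<in> set_pmf outcome"
    show "\<alpha> * real n / real r * indicat_real ?A h \<le> N h"
    proof (cases "h \<in> ?A")
      case True
      then obtain C where C: "finite C" "\<And>W. W \<in> C \<Longrightarrow> W \<subseteq> {1..n} \<and> card W = r"
        "\<And>W e. W \<in> C \<Longrightarrow> e \<subseteq> W \<Longrightarrow> card e = 2 \<Longrightarrow> e \<in> purchased h"
        "\<And>W W'. W \<in> C \<Longrightarrow> W' \<in> C \<Longrightarrow> W \<noteq> W' \<Longrightarrow> W \<inter> W' = {}"
        "\<alpha> * real n / real r \<le> real (card C)"
        using partial_factor_cliques[of \<alpha> r "{1..n}" "purchased h"] r by auto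
      have "card C \<le> card (sized (clusters h) r R) + card {x \<in> {1..n}. \<not> alive (clusters h) x}"
        by (rule card_disjoint_cliques[OF outcome_distinct(1,3)[OF h] r C(1-4), folded assms(3)])
      with card_not_alive[OF threshold_pos, of h] have "real (card C) \<le> N h"
        unfolding N_def by linarith
      with C(5) True show ?thesis by simp
    qed (simp add: N_nonneg)
  qed
  also have "\<dots> = mean r R + (\<Sum>k\<le>r. \<Sum>m\<le>R. real k * mean k m / ?T k m)"
    unfolding N_def mean_def
    by (simp add: integrable_measure_pmf_finite finite_outcome)
  also have "\<dots> \<le> real n * coef L r R R * q ^ r * p ^ R / q + (\<Sum>k\<le>r. \<Sum>m\<le>R. real r * (real n / L))"
  proof (intro add_mono sum_mono mean_le order_refl)
    fix k m assume "k \<in> {..r}" "m \<in> {..R}"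
    then have km: "k \<le> r" "m \<le> R" by auto
    \<comment> \<open>The threshold is \<open>L / n\<close> times the bound on the mean, so each
      \<open>(k, m)\<close> contributes at most \<open>r * n / L\<close> expected dead
      vertices.\<close>
    have "mean k m / ?T k m \<le> (real n * coef L r R m * q ^ k * p ^ m / q) / ?T k m"
      using mean_le[OF km] threshold_pos by (intro divide_right_mono) (auto simp: less_imp_le)
    also have "\<dots> = real n / L"
      using q p L coef_pos[OF r, of L R m] by (simp add: threshold_def)
    finally have "real k * (mean k m / ?T k m) \<le> real r * (real n / L)"
      using km L by (intro mult_mono) (auto simp: mean_def intro!: divide_nonneg_nonneg less_imp_le[OF threshold_pos])
    then show "real k * mean k m / ?T k m \<le> real r * (real n / L)" by simp
  qed
  also have "\<dots> = real n * (coef L r R R * q ^ r * p ^ R / q + real (r + 1) * real (R + 1) * real r / L)"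
    by (simp add: algebra_simps)
  finally have "real n * (\<alpha> / (2 * real r)) \<le> \<dots>" by (simp add: mult.commute)
  then show ?thesis by (rule mult_left_le_imp_le) (use n in simp)
qed

end

subsection \<open>The lower bound\<close>

lemma half_power_le_choose_two:
  assumes "n \<ge> 2"
  shows "(real n / 2) ^ 2 \<le> real (n choose 2)"
proof -
  have "real (n choose 2) = real n * (real n - 1) / 2"
    using assms by (simp add: choose_two real_of_nat_div of_nat_diff)
  moreover have "real n * (real n / 2) \<le> real n * (real n - 1)"
    using assms by (intro mult_left_mono) auto
  ultimately show ?thesis by (simp add: power2_eq_square)
qed

text \<open>Makes \<open>p\<close> and \<open>q\<close> positive below. An event of positive
  probability has an outcome realising it, whose factor contains a clique with an edge, and that
  edge was presented and purchased.\<close>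

lemma partial_factor_nontrivial:
  assumes success: "measure_pmf.prob (builder_graph n t S) {G. has_partial_factor \<alpha> (complete_ugraph r) G} \<ge> 1 / 2"
    and "is_strategy n t b S" "n \<ge> 1" "r \<ge> 2" "\<alpha> > 0"
  shows "t > 0" "b > 0"
proof -
  have "set_pmf (builder_graph n t S) \<inter> {G. has_partial_factor \<alpha> (complete_ugraph r) G} \<noteq> {}"
    (is "?X \<noteq> {}")
  proof
    assume "?X = {}"
    then have "measure_pmf.prob (builder_graph n t S) {G. has_partial_factor \<alpha> (complete_ugraph r) G} = 0"
      by (subst measure_pmf_zero_iff)
    with success show False by linarith
  qed
  then obtain h where h: "h \<in> set_pmf (game S [] (edges (complete_ugraph n)) t)"
    "has_partial_factor \<alpha> (complete_ugraph r) ({1..n}, purchased h)"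
    by (auto simp: builder_graph_eq_game)
  obtain C where C: "finite C" "\<And>W. W \<in> C \<Longrightarrow> W \<subseteq> {1..n} \<and> card W = r"
    "\<And>W e. W \<in> C \<Longrightarrow> e \<subseteq> W \<Longrightarrow> card e = 2 \<Longrightarrow> e \<in> purchased h"
    "\<alpha> * real (card {1..n}) / real r \<le> real (card C)"
    by (rule partial_factor_cliques[OF h(2)]) (use \<open>r \<ge> 2\<close> in auto)
  have "0 < \<alpha> * real (card {1..n}) / real r" using assms by simp
  with C(4) have "C \<noteq> {}" by auto
  then obtain W where W: "W \<in> C" by blast
  then obtain e where "e \<subseteq> W" "card e = 2"
    using C(2)[OF W] \<open>r \<ge> 2\<close> obtain_subset_with_card_n by metis
  then have e: "e \<in> purchased h" using C(3) W by blast
  show "t > 0"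
  proof (rule ccontr)
    assume "\<not> t > 0"
    with h(1) have "h = []" by simp
    with e show False by (simp add: purchased_def)
  qed
  have "finite (purchased h)" by (rule finite_subset[OF purchased_subset]) simp
  with e have "card (purchased h) > 0" by (auto simp: card_gt_0_iff)
  moreover have "card (purchased h) \<le> b"
    using assms(2) h(1) by (auto simp: is_strategy_def builder_graph_eq_game)
  ultimately show "b > 0" by simp
qed

text \<open>\<open>L\<close> is so large that dead vertices account for at most half of the required
  \<open>\<alpha> / (2 * r)\<close>; the rest bounds \<open>q ^ (r - 1) * p ^ R\<close> from below.
  An \<open>(r - 1)\<close>-th root then isolates \<open>b\<close>, and the minimum with 1 in
  \<open>\<beta>\<close> lets the same constant survive the root.\<close>

lemma budget_lower_bound:
  fixes n t b r :: nat and \<alpha> :: real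
  defines "R \<equiv> r choose 2"
  defines "L \<equiv> 4 * real r ^ 2 * real (r + 1) * real (R + 1) / \<alpha>"
  defines "\<beta> \<equiv> min 1 (\<alpha> / (4 * real r * coef L r R R))"
  assumes success: "measure_pmf.prob (builder_graph n t S) {G. has_partial_factor \<alpha> (complete_ugraph r) G} \<ge> 1 / 2"
    and strat: "is_strategy n t b S" and "n \<ge> 2" "r \<ge> 2" "\<alpha> > 0" "t \<le> n choose 2"
  shows "\<beta> / 2 ^ (r - 2) * (real n ^ (r - 1) / real t powr (real r / 2 - 1)) \<le> real b"
proof -
  have tb: "t > 0" "b > 0"
    using partial_factor_nontrivial[OF success strat] assms by auto
  let ?M = "real (n choose 2)" and ?a = "real r / 2 - 1"
  define p where "p = real t / ?M"
  \<comment> \<open>Chosen so that \<open>real n * q * p\<close> is exactly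
    \<open>b\<close>.\<close>
  define q where "q = real b / real n / p"
  have M: "?M > 0" using \<open>n \<ge> 2\<close> by (simp add: zero_less_binomial)
  have p: "p > 0" using M tb by (simp add: p_def)
  have q: "q > 0" using p tb \<open>n \<ge> 2\<close> by (simp add: q_def)
  have L: "L > 0" using \<open>r \<ge> 2\<close> \<open>\<alpha> > 0\<close> by (simp add: L_def)
  have coef: "coef L r R R > 0" using \<open>r \<ge> 2\<close> by (intro coef_pos) simp
  have b_eq: "real n * q * p = real b" using p \<open>n \<ge> 2\<close> by (simp add: q_def)
  interpret builder_game n t r R L q p S
  proof
    fix h assume "h \<in> set_pmf (game S [] (edges (complete_ugraph n)) t)"
    then show "real (card (purchased h)) \<le> real n * q * p"
      unfolding b_eq using strat by (auto simp: is_strategy_def builder_graph_eq_game)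
  qed (use assms p q L in \<open>auto simp: p_def\<close>)
  have "\<alpha> / (2 * real r) \<le> coef L r R R * q ^ r * p ^ R / q + real (r + 1) * real (R + 1) * real r / L"
    using assms by (intro factor_inequality) auto
  also have "real (r + 1) * real (R + 1) * real r / L = \<alpha> / (4 * real r)"
    using \<open>r \<ge> 2\<close> \<open>\<alpha> > 0\<close> by (simp add: L_def field_simps power2_eq_square del: of_nat_add of_nat_Suc)
  finally have "\<alpha> / (4 * real r) \<le> coef L r R R * (q ^ r * p ^ R / q)" by (simp add: field_simps)
  then have "\<alpha> / (4 * real r * coef L r R R) \<le> q ^ r * p ^ R / q"
    using coef \<open>r \<ge> 2\<close> by (simp add: field_simps)
  then have \<beta>_le: "\<beta> \<le> q ^ r * p ^ R / q" by (simp add: \<beta>_def)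
  \<comment> \<open>The \<open>(r - 1)\<close>-th root of \<open>q ^ (r - 1) * p ^ R\<close>: since
    \<open>R = r * (r - 1) / 2\<close>, the exponent \<open>R - (r - 1)\<close> equals
    \<open>(r - 1) * (r / 2 - 1)\<close>.\<close>
  define y where "y = real b / real n * p powr ?a"
  have y_pow: "y ^ (r - 1) = q ^ r * p ^ R / q"
  proof -
    have "real R = real r * (real r - 1) / 2"
      using \<open>r \<ge> 2\<close> by (simp add: R_def choose_two real_of_nat_div of_nat_diff)
    then have "?a * real (r - 1) = real R - real (r - 1)"
      using \<open>r \<ge> 2\<close> by (simp add: of_nat_diff field_simps)
    then have "(p powr ?a) powr real (r - 1) = p powr (real R - real (r - 1))"
      unfolding powr_powr by (rule arg_cong)
    then have "(p powr ?a) ^ (r - 1) = p ^ R / p ^ (r - 1)"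
      using p unfolding powr_diff by (subst (asm) (1 2 3) powr_realpow) auto
    moreover have "q ^ r = q * q ^ (r - 1)" using \<open>r \<ge> 2\<close> by (simp flip: power_Suc)
    then have "q ^ r * p ^ R / q = q ^ (r - 1) * p ^ R" using q by simp
    ultimately show ?thesis
      by (simp add: y_def power_mult_distrib q_def power_divide)
  qed
  \<comment> \<open>If \<open>y < \<beta> \<le> 1\<close>, then
    \<open>y ^ (r - 1) \<le> y < \<beta>\<close>, a contradiction.\<close>
  have "\<beta> \<le> y"
  proof (rule ccontr)
    assume "\<not> \<beta> \<le> y"
    moreover have "0 \<le> y" by (simp add: y_def)
    moreover have "\<beta> \<le> 1" by (simp add: \<beta>_def)
    ultimately have "y ^ (r - 1) \<le> y ^ 1" using \<open>r \<ge> 2\<close> by (intro power_decreasing) auto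
    with y_pow \<beta>_le \<open>\<not> \<beta> \<le> y\<close> show False by simp
  qed
  have a: "?a \<ge> 0" using \<open>r \<ge> 2\<close> by simp
  have \<beta>: "\<beta> \<ge> 0" using coef \<open>\<alpha> > 0\<close> by (simp add: \<beta>_def)
  \<comment> \<open>The power \<open>n ^ (r - 2)\<close> is read as \<open>n ^ 2\<close> to the
    exponent \<open>r / 2 - 1\<close>; comparing \<open>n ^ 2 / 4\<close> with
    \<open>n choose 2\<close> costs the factor \<open>2 ^ (r - 2)\<close>.\<close>
  have "real n ^ (r - 1) / 2 ^ (r - 2) = real n * (real n / 2) ^ (r - 2)"
  proof -
    have "r - 1 = Suc (r - 2)" using \<open>r \<ge> 2\<close> by simp
    then show ?thesis by (simp add: power_divide)
  qed
  also have "(real n / 2) ^ (r - 2) = ((real n / 2) ^ 2) powr ?a"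
  proof -
    have "((real n / 2) ^ 2) powr ?a = (real n / 2) powr (real 2 * ?a)"
      using \<open>n \<ge> 2\<close> by (subst powr_powr[symmetric], subst powr_realpow) auto
    also have "real 2 * ?a = real (r - 2)" using \<open>r \<ge> 2\<close> by (simp add: of_nat_diff)
    finally show ?thesis using \<open>n \<ge> 2\<close> by (simp add: powr_realpow)
  qed
  also have "\<dots> \<le> ?M powr ?a"
    using half_power_le_choose_two[OF \<open>n \<ge> 2\<close>] a by (intro powr_mono2) auto
  finally have n_le: "real n ^ (r - 1) / 2 ^ (r - 2) \<le> real n * ?M powr ?a"
    by (simp add: mult_left_mono)
  have "\<beta> / 2 ^ (r - 2) * (real n ^ (r - 1) / real t powr ?a)
      = \<beta> * (real n ^ (r - 1) / 2 ^ (r - 2)) / real t powr ?a" by simp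
  also have "\<dots> \<le> y * (real n * ?M powr ?a) / real t powr ?a"
    using n_le \<open>\<beta> \<le> y\<close> \<beta> by (intro divide_right_mono mult_mono) auto
  \<comment> \<open>The powers of \<open>t\<close> and \<open>?M\<close> cancel against
    \<open>p powr ?a\<close>.\<close>
  also have "\<dots> = real b"
    using M tb \<open>n \<ge> 2\<close> by (simp add: y_def p_def powr_divide)
  finally show ?thesis .
qed

theorem theorem1p3:
  fixes r :: nat and \<alpha> :: real and t b :: "nat \<Rightarrow> nat"
  assumes "r \<ge> 2" and "0 < \<alpha>" and "\<alpha> < 1"
    and "\<And>n. n \<ge> 1 \<Longrightarrow> t n \<le> n choose 2"
    and "\<exists>S. successful t b (has_partial_factor \<alpha> (complete_ugraph r)) S"
  shows "(\<lambda>n. real (b n)) \<in> \<Omega>(\<lambda>n. real n ^ (r - 1) / real (t n) powr (real r / 2 - 1))"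
proof -
  obtain S where S: "\<And>n. n \<ge> 1 \<Longrightarrow> is_strategy n (t n) (b n) (S n)"
    "(\<lambda>n. measure_pmf.prob (builder_graph n (t n) (S n))
       {G. has_partial_factor \<alpha> (complete_ugraph r) G}) \<longlonglongrightarrow> 1"
    using assms(5) by (auto simp: successful_def)
  define R where "R = r choose 2"
  define L where "L = 4 * real r ^ 2 * real (r + 1) * real (R + 1) / \<alpha>"
  define \<beta> where "\<beta> = min 1 (\<alpha> / (4 * real r * coef L r R R))"
  have "\<beta> > 0"
    using assms(1,2) coef_pos[of r L R R] by (simp add: \<beta>_def)
  \<comment> \<open>For large \<open>n\<close> the success probability exceeds 1/2, so
    \<open>budget_lower_bound\<close> applies with a constant depending only on \<open>r\<close> and
    \<open>\<alpha>\<close>.\<close>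
  have "eventually (\<lambda>n. measure_pmf.prob (builder_graph n (t n) (S n))
      {G. has_partial_factor \<alpha> (complete_ugraph r) G} > 1 / 2) sequentially"
    using S(2) by (rule order_tendstoD) simp
  then have "eventually (\<lambda>n. \<beta> / 2 ^ (r - 2) * norm (real n ^ (r - 1) / real (t n) powr (real r / 2 - 1))
      \<le> norm (real (b n))) sequentially"
    using eventually_ge_at_top[of 2]
  proof eventually_elim
    case (elim n)
    then show ?case
      using budget_lower_bound[of n "t n" "S n" \<alpha> r "b n"] S(1)[of n] assms(1,2,4)
      by (simp add: \<beta>_def L_def R_def)
  qed
  then show ?thesis
    using \<open>\<beta> > 0\<close> by (intro landau_omega.bigI[of "\<beta> / 2 ^ (r - 2)"]) auto
qed

end
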